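(* Let $I,J$ be finite sets, let $A\in\mathbb{R}^{J\times I}$ have columns $f_i$ ($i\in I$), and let $\mathcal{E}_A=\{p_\theta:\theta\in\mathbb{R}^J\}$ be the corresponding discrete exponential family. Let $n=(n(i))_{i\in I}$ be a nonzero vector of observed counts with support $I_+=\{i\in I:n(i)>0\}$, let $F_t\subseteq I$ be the smallest facial set containing $I_+$, and let $p^*$ be the extended maximum likelihood estimate for $n$. Let $F_1,F_2$ be sets with $I_+\subseteq F_1\subseteq F_t\subseteq F_2\subseteq I$. Choose an element of $I_+$, denoted $0$, and put $\mu_i(\theta)=\langle\theta,f_i-f_0\rangle$ for $i\in I$. Choose $L_1\subseteq L_2\subseteq L$ as follows: $L_1$ is a maximal subset of $F_1$ such that the $\mu_i$, $i\in L_1$, are linearly independent (as linear functions of $\theta$); $L_2\subseteq F_2$ is obtained by extending $L_1$ by elements of $F_2\setminus F_1$ to a maximal subset of $F_2$ such that the $\mu_i$, $i\in L_2$, are linearly independent; $L\subseteq I$ is obtained by extending $L_2$ by elements of $I\setminus F_2$ to a maximal subset of $I$ such that the $\mu_i$, $i\in L$, are linearly independent. Suppose that $\theta^{(s)}\in\mathbb{R}^J$, $s\in\mathbb{N}$, are parameter values such that $p_{\theta^{(s)}}\to p^*$ as $s\to\infty$, and let $\mu_i^{(s)}=\langle\theta^{(s)},f_i-f_0\rangle$. Then: 1. For any $i\in L_1$, $\mu_i^{(s)}$ has a well-defined finite limit as $s\to\infty$. Thus, any linear combination of the $\mu_i^{(s)}$ with $i\in L_1$ has a well-defined (finite) limit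 as $s\to\infty$. 2. Any linear combination $\sum_{i\in L}a_i\mu_i^{(s)}$ (with $a_i\in\mathbb{R}$) that has a well-defined finite limit as $s\to\infty$ is in fact a linear combination of the $\mu_i^{(s)}$ with $i\in L_2$, i.e. $a_i=0$ for all $i\in L\setminus L_2$. Thus, a linear combination $\sum_{i\in L}a_i\mu_i^{(s)}$ that involves at least one $\mu_j^{(s)}$ with $j\in L\setminus L_2$ (i.e. $a_j\neq0$) does not have a well-defined finite limit.
   Context: For $\theta\in\mathbb{R}^J$, $p_\theta(i)=\exp(\langle\theta,f_i\rangle-k(\theta))$ with $k(\theta)=\log\sum_{i\in I}\exp\langle\theta,f_i\rangle$, a probability distribution on $I$. The convex support polytope $\mathbf{P}_A$ is the convex hull of $\{f_i:i\in I\}$. A subset $F\subseteq I$ is facial if $F=\{i\in I:f_i\in\mathbf{F}\}$ for some face $\mathbf{F}$ of $\mathbf{P}_A$ (including $\mathbf{P}_A$ itself); every subset of $I$ is contained in a smallest facial set. With $N=\sum_i n(i)$ and $t=An$, $F_t$ is the facial set of the smallest face of $\mathbf{P}_A$ containing $t/N$, equivalently the smallest facial set containing $I_+$. The sets $F_1$ and $F_2$ are arbitrary inner and outer approximations of $F_t$. The extended maximum likelihood estimate $p^*$ is the unique maximizer of $\tilde l(p)=\log\prod_{i\in I}p(i)^{n(i)}$ over the topological closure $\overline{\mathcal{E}_A}$ of $\mathcal{E}_A$. It is a known fact (Barndorff-Nielsen) that it exists, is unique, satisfies $Ap^*=t/N$, and has support exactly $F_t$; moreover $p^*$ lies in $\mathcal{E}_{F_t,A}$,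 the set of distributions that vanish off $F_t$ and are of the form $\exp(\langle\theta,f_i\rangle-k_{F_t}(\theta))$ for $i\in F_t$, where $k_{F_t}(\theta)=\log\sum_{i\in F_t}\exp\langle\theta,f_i\rangle$. A linear combination of parameters has a "well-defined finite limit" if for every sequence $\theta^{(s)}$ with $p_{\theta^{(s)}}\to p^*$ the limit as $s\to\infty$ exists, is finite, and its value does not depend on the choice of the sequence. *)

theory Defs
  imports "HOL-Analysis.Analysis"
begin

text \<open>
  The design matrix \<open>A \<in> \<real>\<^bsup>J \<times> I\<^esup>\<close> has type \<^typ>\<open>real^'i^'j\<close>, so the vector \<open>f\<^sub>i\<close> is
  \<^term>\<open>column i A\<close>. Distributions on \<open>I\<close> are vectors of type \<^typ>\<open>real^'i\<close>.
\<close>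

definition log_partition :: "real^'i^'j \<Rightarrow> real^'j \<Rightarrow> real" where
  "log_partition A \<theta> = ln (\<Sum>i\<in>UNIV. exp (\<theta> \<bullet> column i A))"

definition exp_density :: "real^'i^'j \<Rightarrow> real^'j \<Rightarrow> real^'i" where
  "exp_density A \<theta> = (\<chi> i. exp (\<theta> \<bullet> column i A - log_partition A \<theta>))"

definition exp_family :: "real^'i^'j \<Rightarrow> (real^'i) set" where
  "exp_family A = range (exp_density A)"

definition support_polytope :: "real^'i^'j \<Rightarrow> (real^'j) set" where
  "support_polytope A = convex hull (range (\<lambda>i. column i A))"

definition facial :: "real^'i^'j \<Rightarrow> 'i set \<Rightarrow> bool" where
  "facial A F \<longleftrightarrow> (\<exists>G. G face_of support_polytope A \<and> F = {i. column i A \<in> G})"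

definition smallest_facial :: "real^'i^'j \<Rightarrow> 'i set \<Rightarrow> 'i set \<Rightarrow> bool" where
  "smallest_facial A S F \<longleftrightarrow>
     facial A F \<and> S \<subseteq> F \<and> (\<forall>G. facial A G \<and> S \<subseteq> G \<longrightarrow> F \<subseteq> G)"

definition count_support :: "('i \<Rightarrow> nat) \<Rightarrow> 'i set" where
  "count_support n = {i. n i > 0}"

text \<open>
  The log-likelihood is extended-real valued because \<open>log 0 = -\<infinity>\<close> matters on the boundary of
  the model, whereas \<open>ln 0 = 0\<close> in HOL. Counts of zero contribute the factor \<open>p(i)\<^sup>0 = 1\<close>,
  also if \<open>p(i) = 0\<close>.
\<close>

definition log_likelihood :: "('i::finite \<Rightarrow> nat) \<Rightarrow> real^'i \<Rightarrow> ereal" where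
  "log_likelihood n p =
     (let l = (\<Prod>i\<in>UNIV. (p $ i) ^ n i) in if l > 0 then ereal (ln l) else - \<infinity>)"

text \<open>
  Extended maximum likelihood estimate: a maximizer over the closure of the model. Uniqueness of
  the maximizer is a theorem and deliberately not part of the definition.
\<close>

definition is_EMLE :: "real^'i^'j \<Rightarrow> ('i::finite \<Rightarrow> nat) \<Rightarrow> real^'i \<Rightarrow> bool" where
  "is_EMLE A n p \<longleftrightarrow> is_arg_max (log_likelihood n) (\<lambda>q. q \<in> closure (exp_family A)) p"

definition mu :: "real^'i^'j \<Rightarrow> 'i \<Rightarrow> 'i \<Rightarrow> real^'j \<Rightarrow> real" where
  "mu A z i \<theta> = \<theta> \<bullet> (column i A - column z A)"

text \<open>
  Linear independence of an indexed family of functions; in particular, the members of an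
  independent family are pairwise distinct.
\<close>

definition lin_indep_on :: "('i::finite \<Rightarrow> 'b \<Rightarrow> real) \<Rightarrow> 'i set \<Rightarrow> bool" where
  "lin_indep_on g L \<longleftrightarrow>
     (\<forall>c. (\<forall>\<theta>. (\<Sum>i\<in>L. c i * g i \<theta>) = 0) \<longrightarrow> (\<forall>i\<in>L. c i = 0))"

definition maximal_lin_indep :: "('i::finite \<Rightarrow> 'b \<Rightarrow> real) \<Rightarrow> 'i set \<Rightarrow> 'i set \<Rightarrow> bool" where
  "maximal_lin_indep g F L \<longleftrightarrow>
     L \<subseteq> F \<and> lin_indep_on g L \<and>
     (\<forall>L'. L \<subseteq> L' \<and> L' \<subseteq> F \<and> lin_indep_on g L' \<longrightarrow> L' = L)"

text \<open>
  \<open>g\<close> is a function of the parameter and \<open>p\<close> the limit distribution. Since \<open>g\<close> is real valued,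
  \<^const>\<open>convergent\<close> means that the limit exists and is finite.
\<close>

definition well_defined_limit ::
  "real^'i^'j \<Rightarrow> real^'i \<Rightarrow> (real^'j \<Rightarrow> real) \<Rightarrow> bool" where
  "well_defined_limit A p g \<longleftrightarrow>
     (\<forall>\<theta>. (\<lambda>s. exp_density A (\<theta> s)) \<longlonglongrightarrow> p \<longrightarrow> convergent (\<lambda>s. g (\<theta> s))) \<and>
     (\<forall>\<theta> \<theta>'. (\<lambda>s. exp_density A (\<theta> s)) \<longlonglongrightarrow> p \<and> (\<lambda>s. exp_density A (\<theta>' s)) \<longlonglongrightarrow> p \<longrightarrow>
        lim (\<lambda>s. g (\<theta> s)) = lim (\<lambda>s. g (\<theta>' s)))"

end

theory Submission
  imports Defs
begin

text \<open>
  Everything rests on two facts about the support of the extended maximum likelihood estimate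
  \<open>p\<close> and on the behaviour of the model under translation of the parameter.

  Translating \<open>\<theta>\<close> by \<open>d\<close> multiplies \<open>p\<^sub>\<theta>(i)\<close> by \<open>exp \<langle>d, f\<^sub>i\<rangle>\<close> and renormalizes. This formula
  makes sense for every probability distribution and is continuous, so translating a sequence of
  parameters by a constant \<open>d\<close> tilts the limit distribution in the same way.

  The support of \<open>p\<close> lies in \<open>F\<^sub>t\<close>: the face behind \<open>F\<^sub>t\<close> is exposed by some linear functional
  \<open>a\<close>, and tilting \<open>p\<close> by \<open>a\<close> moves mass from the complement of \<open>F\<^sub>t\<close> to \<open>F\<^sub>t\<close>,
  in proportion to the mass already there. If there were mass to move, this would strictly
  increase the likelihood, which depends only on the values on \<open>I\<^sub>+ \<subseteq> F\<^sub>t\<close>.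

  The support of \<open>p\<close> contains \<open>F\<^sub>t\<close>: for \<open>i \<in> F\<^sub>t\<close> the mean \<open>x = t/N\<close> is a convex combination of
  the \<open>f\<^sub>k\<close> that gives positive weight to \<open>f\<^sub>i\<close>. Averages of \<open>ln p\<^sub>\<theta>(k)\<close> under weights with the
  same mean agree, so \<open>ln p\<^sub>\<theta>(i)\<close> is bounded below by a fixed multiple of the log-likelihood,
  which stays bounded as \<open>p\<^sub>\<theta>\<close> tends to \<open>p\<close>.

  Since \<open>\<mu>\<^sub>i(\<theta>) = ln (p\<^sub>\<theta>(i) / p\<^sub>\<theta>(0))\<close>, the second inclusion gives the limits for \<open>i \<in> L\<^sub>1\<close>. For
  the negative part, linear independence provides a \<open>d\<close> with \<open>\<mu>\<^sub>i(d) = 0\<close> on \<open>L\<^sub>2\<close> and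
  \<open>\<mu>\<^sub>i(d) = a\<^sub>i\<close> on \<open>L - L\<^sub>2\<close>. Then \<open>\<mu>\<^sub>i(d) = 0\<close> on all of \<open>F\<^sub>2\<close>, hence on the support of \<open>p\<close>, so
  that translation by \<open>d\<close> preserves convergence to \<open>p\<close>, but it changes the value of
  \<open>\<Sum>a\<^sub>i \<mu>\<^sub>i\<close> by \<open>\<Sum>a\<^sub>i\<^sup>2\<close>, summed over \<open>L - L\<^sub>2\<close>.
\<close>

section \<open>The smallest face containing a point\<close>

text \<open>
  A point of a convex set lies in the smallest face around \<open>x\<close> exactly if the segment from it
  to \<open>x\<close> can be prolonged beyond \<open>x\<close> within the set.
\<close>

definition face_around :: "'a::real_vector \<Rightarrow> 'a set \<Rightarrow> 'a set" where
  "face_around x S = {y \<in> S. \<exists>e>0. x + e *\<^sub>R (x - y) \<in> S}"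

lemma prolong_shorter:
  fixes S :: "'a::real_vector set"
  assumes "convex S" "x \<in> S" "x + e *\<^sub>R (x - y) \<in> S" "0 < d" "d \<le> e"
  shows "x + d *\<^sub>R (x - y) \<in> S"
proof -
  have "(1 - d/e) *\<^sub>R x + (d/e) *\<^sub>R (x + e *\<^sub>R (x - y)) \<in> S"
    using assms by (intro convexD) (auto simp: field_simps)
  moreover have "(1 - d/e) *\<^sub>R x + (d/e) *\<^sub>R (x + e *\<^sub>R (x - y)) = x + d *\<^sub>R (x - y)"
    using assms by (simp add: algebra_simps)
  ultimately show ?thesis by simp
qed

lemma face_around_face_of:
  fixes S :: "'a::real_vector set"
  assumes "convex S" "x \<in> S"
  shows "face_around x S face_of S"
  unfolding face_of_def
proof (intro conjI ballI impI)
  show "face_around x S \<subseteq> S" by (auto simp: face_around_def)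
  show "convex (face_around x S)"
  proof (rule convexI)
    fix y1 y2 and u v :: real
    assume y: "y1 \<in> face_around x S" "y2 \<in> face_around x S"
      and uv: "0 \<le> u" "0 \<le> v" "u + v = 1"
    obtain e1 e2 where e: "e1 > 0" "e2 > 0"
        "x + e1 *\<^sub>R (x - y1) \<in> S" "x + e2 *\<^sub>R (x - y2) \<in> S"
      and yS: "y1 \<in> S" "y2 \<in> S"
      using y by (auto simp: face_around_def)
    define d where "d = min e1 e2"
    have d: "d > 0" "d \<le> e1" "d \<le> e2" using e by (auto simp: d_def)
    have "x + d *\<^sub>R (x - y1) \<in> S" "x + d *\<^sub>R (x - y2) \<in> S"
      using prolong_shorter[OF assms e(3) d(1,2)] prolong_shorter[OF assms e(4) d(1,3)] .
    then have "u *\<^sub>R (x + d *\<^sub>R (x - y1)) + v *\<^sub>R (x + d *\<^sub>R (x - y2)) \<in> S"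
      using uv by (intro convexD[OF assms(1)])
    moreover have "u *\<^sub>R (x + d *\<^sub>R (x - y1)) + v *\<^sub>R (x + d *\<^sub>R (x - y2))
        = (u + v) *\<^sub>R x + d *\<^sub>R ((u + v) *\<^sub>R x - (u *\<^sub>R y1 + v *\<^sub>R y2))"
      by (simp add: algebra_simps)
    moreover have "u *\<^sub>R y1 + v *\<^sub>R y2 \<in> S"
      using assms(1) yS uv by (intro convexD) auto
    ultimately show "u *\<^sub>R y1 + v *\<^sub>R y2 \<in> face_around x S"
      using d uv by (auto simp: face_around_def)
  qed
next
  \<comment> \<open>One endpoint suffices; the other one follows by reversing the segment.\<close>
  have left: "a \<in> face_around x S"
    if ab: "a \<in> S" "b \<in> S" and y: "y \<in> face_around x S" and u: "0 < u" "u < 1"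
      and yab: "y = (1 - u) *\<^sub>R a + u *\<^sub>R b" for a b y and u :: real
  proof -
    obtain e where e: "e > 0" and w: "x + e *\<^sub>R (x - y) \<in> S"
      using y by (auto simp: face_around_def)
    (* Prolonging the segment from y through x reaches a point w with (1 + e) x = w + e y. Splitting e y
       into its a-part and b-part gives (1 + e) x = e (1 - u) a + (w + e u b), so the point
       (w + e u b) / (1 + e u) of S prolongs the segment from a through x. *)
    define c where "c = 1 + e * u"
    have c: "c > 0" using e u by (simp add: c_def add_pos_pos)
    let ?r = "(1/c) *\<^sub>R (x + e *\<^sub>R (x - y)) + (e * u / c) *\<^sub>R b"
    have "?r \<in> S"
      using assms(1) w ab e u c
      by (intro convexD) (auto simp: c_def add_divide_distrib[symmetric])
    moreover have "?r = x + (e * (1 - u) / c) *\<^sub>R (x - a)"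
    proof -
      have "c *\<^sub>R ?r = c *\<^sub>R (x + (e * (1 - u) / c) *\<^sub>R (x - a))"
        using c by (simp add: scaleR_add_right yab) (simp add: c_def algebra_simps)
      thus ?thesis using c by simp
    qed
    moreover have "e * (1 - u) / c > 0" using e u c by simp
    ultimately show ?thesis using ab by (auto simp: face_around_def)
  qed
  fix a b y
  assume ab: "a \<in> S" "b \<in> S" and y: "y \<in> face_around x S" and "y \<in> open_segment a b"
  then obtain u where u: "0 < u" "u < 1" "y = (1 - u) *\<^sub>R a + u *\<^sub>R b"
    by (auto simp: in_segment)
  show "a \<in> face_around x S" by (rule left[OF ab y u])
  show "b \<in> face_around x S"
    by (rule left[where u = "1 - u", OF ab(2,1) y]) (use u in \<open>auto simp: algebra_simps\<close>)
qed

lemma convex_hull_range_finite: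
  fixes f :: "'i::finite \<Rightarrow> 'a::real_vector"
  shows "y \<in> convex hull (range f) \<longleftrightarrow>
    (\<exists>v. (\<forall>k. v k \<ge> 0) \<and> (\<Sum>k\<in>UNIV. v k) = 1 \<and> (\<Sum>k\<in>UNIV. v k *\<^sub>R f k) = y)"
  (is "_ \<longleftrightarrow> ?R y")
proof
  have "range f \<subseteq> {y. ?R y}"
  proof clarify
    fix i
    show "?R (f i)"
      by (intro exI[of _ "\<lambda>k. if k = i then 1 else 0"])
         (auto simp: if_distrib[where f = "\<lambda>c. c *\<^sub>R _"] cong: if_cong)
  qed
  moreover have "convex {y. ?R y}"
  proof (rule convexI, clarify)
    fix v w :: "'i \<Rightarrow> real" and a b :: real
    assume "\<forall>k. v k \<ge> 0" "sum v UNIV = 1" "\<forall>k. w k \<ge> 0" "sum w UNIV = 1"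
      "0 \<le> a" "0 \<le> b" "a + b = 1"
    then show "?R (a *\<^sub>R (\<Sum>k\<in>UNIV. v k *\<^sub>R f k) + b *\<^sub>R (\<Sum>k\<in>UNIV. w k *\<^sub>R f k))"
      by (intro exI[of _ "\<lambda>k. a * v k + b * w k"])
         (simp add: sum.distrib sum_distrib_left[symmetric] scaleR_add_left
            scaleR_sum_right)
  qed
  ultimately have "convex hull (range f) \<subseteq> {y. ?R y}" by (rule hull_minimal)
  then show "?R y" if "y \<in> convex hull (range f)" using that by blast
next
  assume "?R y"
  then show "y \<in> convex hull (range f)"
    using hull_subset[of "range f" convex] by (auto intro!: convex_sum[OF _ convex_convex_hull])
qed

text \<open>
  With \<open>q = w i\<close>, prolonging the segment from \<open>f\<^sub>i\<close> by the factor \<open>q\<close> leaves the weight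
  \<open>(1 + q) q - q = q\<^sup>2\<close> on \<open>f\<^sub>i\<close>, which is still nonnegative.
\<close>

lemma weighted_mean_prolong:
  fixes f :: "'i::finite \<Rightarrow> 'a::real_vector" and w :: "'i \<Rightarrow> real"
  assumes "\<And>k. w k \<ge> 0" "sum w UNIV = 1" "w i > 0"
  shows "f i \<in> face_around (\<Sum>k\<in>UNIV. w k *\<^sub>R f k) (convex hull (range f))"
proof -
  let ?x = "\<Sum>k\<in>UNIV. w k *\<^sub>R f k"
  define v where "v k = (1 + w i) * w k - (if k = i then w i else 0)" for k
  have "v k \<ge> 0" for k using assms by (auto simp: v_def algebra_simps)
  moreover have "sum v UNIV = 1"
    using assms(2) by (simp add: v_def sum_subtractf sum_distrib_left[symmetric])
  moreover have "(\<Sum>k\<in>UNIV. v k *\<^sub>R f k) = ?x + w i *\<^sub>R (?x - f i)"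
  proof -
    have "v k *\<^sub>R f k = (1 + w i) *\<^sub>R (w k *\<^sub>R f k) - (if k = i then w i *\<^sub>R f i else 0)" for k
      by (simp add: v_def algebra_simps)
    then have "(\<Sum>k\<in>UNIV. v k *\<^sub>R f k) = (1 + w i) *\<^sub>R ?x - w i *\<^sub>R f i"
      by (simp add: sum_subtractf scaleR_sum_right)
    then show ?thesis by (simp add: algebra_simps)
  qed
  ultimately have "?x + w i *\<^sub>R (?x - f i) \<in> convex hull (range f)"
    unfolding convex_hull_range_finite by blast
  then show ?thesis using assms(3) by (auto simp: face_around_def intro: hull_inc)
qed

text \<open>
  The face around the mean \<open>x\<close> of \<open>w\<close> contains every \<open>f\<^sub>k\<close> charged by \<open>w\<close>, hence \<open>F\<close>, which is the
  smallest such facial set. So the segment from \<open>f\<^sub>i\<close> to \<open>x\<close> can be prolonged to some point of the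
  polytope, and \<open>x\<close> is a proper mixture of that point with \<open>f\<^sub>i\<close>.
\<close>

lemma smallest_facial_mean_representation:
  fixes A :: "real^'i::finite^'j::finite" and w :: "'i \<Rightarrow> real"
  assumes sf: "smallest_facial A {k. w k > 0} F" and "i \<in> F"
    and w: "\<And>k. w k \<ge> 0" "sum w UNIV = 1"
  shows "\<exists>v. (\<forall>k. v k \<ge> 0) \<and> sum v UNIV = 1 \<and> v i > 0 \<and>
    (\<Sum>k\<in>UNIV. v k *\<^sub>R column k A) = (\<Sum>k\<in>UNIV. w k *\<^sub>R column k A)"
proof -
  let ?P = "support_polytope A"
  define x where "x = (\<Sum>k\<in>UNIV. w k *\<^sub>R column k A)"
  have "x \<in> ?P"
    unfolding support_polytope_def convex_hull_range_finite x_def using w by blast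
  moreover have "convex ?P" by (simp add: support_polytope_def)
  ultimately have "face_around x ?P face_of ?P" by (intro face_around_face_of)
  then have "facial A {k. column k A \<in> face_around x ?P}"
    unfolding facial_def by blast
  moreover have "{k. w k > 0} \<subseteq> {k. column k A \<in> face_around x ?P}"
    using weighted_mean_prolong[of w _ "\<lambda>k. column k A"] w
    by (auto simp: x_def support_polytope_def)
  ultimately have "column i A \<in> face_around x ?P"
    using sf \<open>i \<in> F\<close> by (auto simp: smallest_facial_def)
  then obtain e u where e: "e > 0" and u: "\<And>k. u k \<ge> 0" "sum u UNIV = 1"
      and ux: "(\<Sum>k\<in>UNIV. u k *\<^sub>R column k A) = x + e *\<^sub>R (x - column i A)"
    unfolding face_around_def support_polytope_def convex_hull_range_finite by auto
  define v where "v k = (u k + (if k = i then e else 0)) / (1 + e)" for k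
  have "v k \<ge> 0" for k using u(1)[of k] e by (auto simp: v_def)
  moreover have "sum v UNIV = 1"
    using u(2) e by (simp add: v_def sum_divide_distrib[symmetric] sum.distrib)
  moreover have "v i > 0" using u(1)[of i] e by (simp add: v_def add_nonneg_pos)
  moreover have "(\<Sum>k\<in>UNIV. v k *\<^sub>R column k A) = x"
  proof -
    have "(1 + e) *\<^sub>R (v k *\<^sub>R column k A)
        = u k *\<^sub>R column k A + (if k = i then e *\<^sub>R column i A else 0)" for k
      using e by (simp add: v_def scaleR_add_left)
    then have "(1 + e) *\<^sub>R (\<Sum>k\<in>UNIV. v k *\<^sub>R column k A)
        = (\<Sum>k\<in>UNIV. u k *\<^sub>R column k A) + e *\<^sub>R column i A"
      by (simp add: scaleR_sum_right sum.distrib)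
    also have "\<dots> = (1 + e) *\<^sub>R x" by (simp add: ux algebra_simps)
    finally show ?thesis using e by simp
  qed
  ultimately show ?thesis unfolding x_def by blast
qed


section \<open>Distributions in the model and its closure\<close>

lemma exp_density_nth:
  fixes A :: "real^'i::finite^'j::finite"
  shows "exp_density A \<theta> $ i = exp (\<theta> \<bullet> column i A) / (\<Sum>k\<in>UNIV. exp (\<theta> \<bullet> column k A))"
proof -
  have "(\<Sum>k\<in>UNIV. exp (\<theta> \<bullet> column k A)) > 0" by (intro sum_pos) auto
  then show ?thesis by (simp add: exp_density_def log_partition_def exp_diff)
qed

lemma exp_density_pos: "exp_density A \<theta> $ i > 0"
  by (simp add: exp_density_def)

lemma exp_density_sum:
  fixes A :: "real^'i::finite^'j::finite"
  shows "(\<Sum>i\<in>UNIV. exp_density A \<theta> $ i) = 1"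
proof -
  have "(\<Sum>k\<in>UNIV. exp (\<theta> \<bullet> column k A)) > 0" by (intro sum_pos) auto
  then show ?thesis by (simp add: exp_density_nth sum_divide_distrib[symmetric])
qed

lemma exp_density_le_1:
  fixes A :: "real^'i::finite^'j::finite"
  shows "exp_density A \<theta> $ i \<le> 1"
  using member_le_sum[of i UNIV "\<lambda>k. exp_density A \<theta> $ k"] exp_density_pos[of A \<theta>]
  by (simp add: exp_density_sum less_imp_le)

lemma mu_eq_ln_ratio:
  "mu A z i \<theta> = ln (exp_density A \<theta> $ i / exp_density A \<theta> $ z)"
  by (simp add: mu_def exp_density_def exp_diff[symmetric] inner_diff_right)

lemma exp_family_closure_sequence:
  assumes "p \<in> closure (exp_family A)"
  obtains \<theta> where "(\<lambda>s. exp_density A (\<theta> s)) \<longlonglongrightarrow> p"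
proof -
  obtain q where q: "\<And>s. q s \<in> exp_family A" "q \<longlonglongrightarrow> p"
    using assms by (auto simp: closure_sequential)
  then have "\<forall>s. \<exists>\<theta>. q s = exp_density A \<theta>" by (auto simp: exp_family_def)
  then obtain \<theta> where "\<And>s. q s = exp_density A (\<theta> s)" by metis
  then have "q = (\<lambda>s. exp_density A (\<theta> s))" by (rule ext)
  with q(2) that show ?thesis by simp
qed

lemma exp_density_limit_distribution:
  fixes A :: "real^'i::finite^'j::finite"
  assumes "(\<lambda>s. exp_density A (\<theta> s)) \<longlonglongrightarrow> p"
  shows "p $ i \<ge> 0" and "(\<Sum>i\<in>UNIV. p $ i) = 1"
proof -
  have lim: "(\<lambda>s. exp_density A (\<theta> s) $ i) \<longlonglongrightarrow> p $ i" for i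
    using assms by (rule tendsto_vec_nth)
  show "p $ i \<ge> 0"
    by (rule LIMSEQ_le_const[OF lim]) (auto intro: less_imp_le exp_density_pos)
  have "(\<lambda>s. \<Sum>i\<in>UNIV. exp_density A (\<theta> s) $ i) \<longlonglongrightarrow> (\<Sum>i\<in>UNIV. p $ i)"
    by (intro tendsto_sum lim)
  then show "(\<Sum>i\<in>UNIV. p $ i) = 1" by (simp add: exp_density_sum LIMSEQ_const_iff)
qed

text \<open>
  The exponential tilt describes the translation \<open>\<theta> \<mapsto> \<theta> + d\<close> of the parameter space in a way
  that extends to the closure of the model, where no parameter is available.
\<close>

definition tilt :: "real^'i^'j \<Rightarrow> real^'j \<Rightarrow> real^'i \<Rightarrow> real^'i" where
  "tilt A d p = (\<chi> i. p $ i * exp (d \<bullet> column i A) / (\<Sum>k\<in>UNIV. p $ k * exp (d \<bullet> column k A)))"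

lemma exp_density_translate:
  fixes A :: "real^'i::finite^'j::finite"
  shows "exp_density A (\<theta> + d) = tilt A d (exp_density A \<theta>)"
proof -
  define Z where "Z = (\<Sum>k\<in>UNIV. exp (\<theta> \<bullet> column k A))"
  have Z: "Z > 0" unfolding Z_def by (intro sum_pos) auto
  have "(\<Sum>k\<in>UNIV. exp_density A \<theta> $ k * exp (d \<bullet> column k A))
      = (\<Sum>k\<in>UNIV. exp ((\<theta> + d) \<bullet> column k A)) / Z"
    by (simp add: exp_density_nth Z_def sum_divide_distrib inner_add_left exp_add)
  then show ?thesis
    using Z unfolding tilt_def vec_eq_iff
    by (auto simp: exp_density_nth[of A] Z_def[symmetric] inner_add_left exp_add)
qed

lemma tilt_normalizer_pos:
  fixes A :: "real^'i::finite^'j::finite"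
  assumes "\<And>i. p $ i \<ge> 0" "(\<Sum>i\<in>UNIV. p $ i) = 1"
  shows "(\<Sum>k\<in>UNIV. p $ k * exp (d \<bullet> column k A)) > 0"
proof -
  have "\<exists>i. p $ i \<noteq> 0" using assms(2) by (metis sum.neutral zero_neq_one)
  then obtain i where "p $ i > 0" using assms(1) by (auto simp: less_le)
  then show ?thesis by (intro sum_pos2[of _ i]) (auto simp: assms(1))
qed

lemma exp_density_translate_tendsto:
  fixes A :: "real^'i::finite^'j::finite"
  assumes "(\<lambda>s. exp_density A (\<theta> s)) \<longlonglongrightarrow> p"
  shows "(\<lambda>s. exp_density A (\<theta> s + d)) \<longlonglongrightarrow> tilt A d p"
proof -
  have "(\<Sum>k\<in>UNIV. p $ k * exp (d \<bullet> column k A)) \<noteq> 0"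
    using tilt_normalizer_pos[of p d A] exp_density_limit_distribution[OF assms] by simp
  then show ?thesis
    unfolding exp_density_translate tilt_def
    by (intro vec_tendstoI) (auto intro!: tendsto_intros assms)
qed

lemma tilt_in_closure:
  fixes A :: "real^'i::finite^'j::finite"
  assumes "p \<in> closure (exp_family A)"
  shows "tilt A d p \<in> closure (exp_family A)"
proof -
  obtain \<theta> where "(\<lambda>s. exp_density A (\<theta> s)) \<longlonglongrightarrow> p"
    using exp_family_closure_sequence[OF assms] .
  from exp_density_translate_tendsto[OF this, of d] show ?thesis
    unfolding closure_sequential exp_family_def
    by (intro exI[of _ "\<lambda>s. exp_density A (\<theta> s + d)"] conjI allI rangeI)
qed

lemma tilt_trivial:
  fixes A :: "real^'i::finite^'j::finite"
  assumes "(\<Sum>i\<in>UNIV. p $ i) = 1" and "\<And>i. p $ i \<noteq> 0 \<Longrightarrow> mu A z i d = 0"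
  shows "tilt A d p = p"
proof -
  have *: "p $ k * exp (d \<bullet> column k A) = p $ k * exp (d \<bullet> column z A)" for k
    using assms(2)[of k] by (cases "p $ k = 0") (auto simp: mu_def inner_diff_right)
  show ?thesis
    by (simp add: tilt_def * sum_distrib_right[symmetric] assms(1) vec_eq_iff)
qed


section \<open>The support of the extended maximum likelihood estimate\<close>

lemma EMLE_likelihood_ge:
  fixes A :: "real^'i::finite^'j::finite"
  assumes "is_EMLE A n p" "q \<in> closure (exp_family A)" "(\<Prod>i\<in>UNIV. (q $ i) ^ n i) > 0"
  shows "(\<Prod>i\<in>UNIV. (q $ i) ^ n i) \<le> (\<Prod>i\<in>UNIV. (p $ i) ^ n i)"
proof -
  have "\<not> log_likelihood n q > log_likelihood n p"
    using assms(1,2) by (auto simp: is_EMLE_def is_arg_max_def)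
  then show ?thesis
    using assms(3) by (auto simp: log_likelihood_def Let_def not_less split: if_splits)
qed

lemma EMLE_likelihood_pos:
  fixes A :: "real^'i::finite^'j::finite"
  assumes "is_EMLE A n p"
  shows "(\<Prod>i\<in>UNIV. (p $ i) ^ n i) > 0"
proof -
  have "exp_density A 0 \<in> closure (exp_family A)"
    by (intro subsetD[OF closure_subset]) (auto simp: exp_family_def)
  moreover have "(\<Prod>i\<in>UNIV. (exp_density A 0 $ i) ^ n i) > 0"
    by (intro prod_pos) (auto simp: exp_density_pos)
  ultimately show ?thesis using EMLE_likelihood_ge[OF assms] by fastforce
qed

lemma EMLE_pos_count_support:
  fixes A :: "real^'i::finite^'j::finite"
  assumes "is_EMLE A n p" "\<And>i. p $ i \<ge> 0" "i \<in> count_support n"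
  shows "p $ i > 0"
proof -
  have "(\<Prod>i\<in>UNIV. (p $ i) ^ n i) \<noteq> 0"
    using EMLE_likelihood_pos[OF assms(1)] by linarith
  then have "p $ i ^ n i \<noteq> 0" by (metis UNIV_I finite prod_zero_iff)
  then have "p $ i \<noteq> 0" using assms(3) by (auto simp: count_support_def)
  then show ?thesis using assms(2)[of i] by linarith
qed

lemma total_count_pos:
  fixes n :: "'i::finite \<Rightarrow> nat"
  assumes "n \<noteq> (\<lambda>_. 0)"
  shows "(\<Sum>k\<in>UNIV. n k) > 0"
proof -
  obtain k where "n k > 0" using assms by (auto simp: fun_eq_iff)
  then show ?thesis by (intro sum_pos2[of _ k]) auto
qed

text \<open>
  For \<open>i \<in> F\<^sub>t\<close> two weightings with the same mean give
  \<open>v i * ln p\<^sub>\<theta>(i) \<ge> \<Sum>k. v k * ln p\<^sub>\<theta>(k) = \<Sum>k. w k * ln p\<^sub>\<theta>(k)\<close>, and the right-hand side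
  converges because \<open>w\<close> only charges points where the limit is positive.
\<close>

lemma limit_pos_on_smallest_facial:
  fixes A :: "real^'i::finite^'j::finite" and w :: "'i \<Rightarrow> real"
  assumes lim: "(\<lambda>s. exp_density A (\<theta> s)) \<longlonglongrightarrow> p"
    and sf: "smallest_facial A {k. w k > 0} F" and "i \<in> F"
    and w: "\<And>k. w k \<ge> 0" "sum w UNIV = 1"
    and pos: "\<And>k. w k > 0 \<Longrightarrow> p $ k > 0"
  shows "p $ i > 0"
proof -
  obtain v where v: "\<And>k. v k \<ge> 0" "sum v UNIV = 1" "v i > 0"
    and mean: "(\<Sum>k\<in>UNIV. v k *\<^sub>R column k A) = (\<Sum>k\<in>UNIV. w k *\<^sub>R column k A)"
    using smallest_facial_mean_representation[OF sf \<open>i \<in> F\<close> w] by blast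
  have average: "(\<Sum>k\<in>UNIV. u k * ln (exp_density A \<theta> $ k))
      = \<theta> \<bullet> (\<Sum>k\<in>UNIV. u k *\<^sub>R column k A) - log_partition A \<theta>"
    if "sum u UNIV = 1" for u \<theta>
    using that
    by (simp add: exp_density_def right_diff_distrib sum_subtractf sum_distrib_right[symmetric]
        inner_sum_right)
  define h where "h q = (\<Sum>k\<in>UNIV. w k * ln (q $ k))" for q :: "real^'i"
  have bound: "exp (h (exp_density A \<theta>) / v i) \<le> exp_density A \<theta> $ i" for \<theta>
  proof -
    have "h (exp_density A \<theta>) = (\<Sum>k\<in>UNIV. v k * ln (exp_density A \<theta> $ k))"
      unfolding h_def by (simp only: average[OF w(2)] average[OF v(2)] mean)
    also have "\<dots> = v i * ln (exp_density A \<theta> $ i)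
        + (\<Sum>k\<in>UNIV - {i}. v k * ln (exp_density A \<theta> $ k))"
      by (simp add: sum.remove[of UNIV i])
    also have "\<dots> \<le> v i * ln (exp_density A \<theta> $ i)"
      using v(1) exp_density_pos[of A \<theta>] exp_density_le_1[of A \<theta>]
      by (auto intro!: sum_nonpos mult_nonneg_nonpos)
    finally have "h (exp_density A \<theta>) / v i \<le> ln (exp_density A \<theta> $ i)"
      using v(3) by (simp add: field_simps)
    then show ?thesis using exp_density_pos[of A \<theta> i] by (simp add: ln_ge_iff)
  qed
  have "(\<lambda>s. w k * ln (exp_density A (\<theta> s) $ k)) \<longlonglongrightarrow> w k * ln (p $ k)" for k
  proof (cases "w k = 0")
    case False
    then have "p $ k > 0" using pos w(1)[of k] by (auto simp: less_le)
    then show ?thesis by (intro tendsto_intros lim) auto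
  qed simp
  then have "(\<lambda>s. h (exp_density A (\<theta> s))) \<longlonglongrightarrow> h p"
    unfolding h_def by (intro tendsto_sum)
  then have "(\<lambda>s. exp (h (exp_density A (\<theta> s)) / v i)) \<longlonglongrightarrow> exp (h p / v i)"
    using v(3) by (intro tendsto_intros) auto
  moreover have "(\<lambda>s. exp_density A (\<theta> s) $ i) \<longlonglongrightarrow> p $ i"
    by (intro tendsto_intros lim)
  ultimately have "exp (h p / v i) \<le> p $ i"
    by (rule LIMSEQ_le) (auto intro: bound)
  then show ?thesis using exp_gt_zero[of "h p / v i"] by linarith
qed

lemma EMLE_pos_on_smallest_facial:
  fixes A :: "real^'i::finite^'j::finite"
  assumes "n \<noteq> (\<lambda>_. 0)" "smallest_facial A (count_support n) F" "is_EMLE A n p" "i \<in> F"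
  shows "p $ i > 0"
proof -
  have "p \<in> closure (exp_family A)" using assms(3) by (simp add: is_EMLE_def is_arg_max_def)
  then obtain \<theta> where lim: "(\<lambda>s. exp_density A (\<theta> s)) \<longlonglongrightarrow> p"
    by (rule exp_family_closure_sequence)
  define N where "N = (\<Sum>k\<in>UNIV. n k)"
  have N: "N > 0" unfolding N_def by (rule total_count_pos[OF assms(1)])
  define w where "w k = real (n k) / real N" for k
  have supp: "{k. w k > 0} = count_support n"
    using N by (auto simp: w_def count_support_def zero_less_divide_iff)
  show ?thesis
  proof (rule limit_pos_on_smallest_facial[OF lim])
    show "smallest_facial A {k. w k > 0} F" using assms(2) supp by simp
    show "sum w UNIV = 1"
    proof -
      have "sum w UNIV = real N / real N"
        unfolding w_def sum_divide_distrib[symmetric] by (simp add: N_def)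
      then show ?thesis using N by simp
    qed
    show "p $ k > 0" if "w k > 0" for k
      using that supp EMLE_pos_count_support[OF assms(3)] exp_density_limit_distribution(1)[OF lim]
      by blast
  qed (use assms in \<open>auto simp: w_def\<close>)
qed

text \<open>
  Faces of polytopes are exposed, so a facial set is where some linear functional \<open>a\<close> attains
  its maximum \<open>b\<close> over the columns. Tilting \<open>p\<close> by \<open>a\<close> multiplies its values on the facial set
  by \<open>exp b\<close> divided by the normalizer, and this factor exceeds 1 as soon as \<open>p\<close> charges a
  point outside.
\<close>

lemma EMLE_zero_off_facial:
  fixes A :: "real^'i::finite^'j::finite"
  assumes "n \<noteq> (\<lambda>_. 0)" "facial A F" "count_support n \<subseteq> F" "is_EMLE A n p" "j \<notin> F"
  shows "p $ j = 0"
proof (rule ccontr)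
  assume "p $ j \<noteq> 0"
  have cl: "p \<in> closure (exp_family A)" using assms(4) by (simp add: is_EMLE_def is_arg_max_def)
  then obtain \<theta> where "(\<lambda>s. exp_density A (\<theta> s)) \<longlonglongrightarrow> p"
    by (rule exp_family_closure_sequence)
  note p = exp_density_limit_distribution[OF this]
  obtain G where G: "G face_of support_polytope A" "F = {i. column i A \<in> G}"
    using assms(2) by (auto simp: facial_def)
  have "polyhedron (support_polytope A)"
    unfolding support_polytope_def
    by (intro polytope_imp_polyhedron polytope_convex_hull) auto
  then have "G exposed_face_of support_polytope A"
    using G(1) by (simp add: exposed_face_of_polyhedron)
  then obtain a b where ab: "support_polytope A \<subseteq> {x. a \<bullet> x \<le> b}"
      "G = support_polytope A \<inter> {x. a \<bullet> x = b}"
    by (auto simp: exposed_face_of_def)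
  have col: "column k A \<in> support_polytope A" for k
    by (simp add: support_polytope_def hull_inc)
  have le: "a \<bullet> column k A \<le> b" and eq: "a \<bullet> column k A = b \<longleftrightarrow> k \<in> F" for k
    using ab col[of k] G(2) by auto
  define Z where "Z = (\<Sum>k\<in>UNIV. p $ k * exp (a \<bullet> column k A))"
  have Z: "Z > 0" unfolding Z_def by (intro tilt_normalizer_pos p)
  have "Z < (\<Sum>k\<in>UNIV. p $ k * exp b)"
    unfolding Z_def
  proof (rule sum_strict_mono_ex1)
    show "\<forall>k\<in>UNIV. p $ k * exp (a \<bullet> column k A) \<le> p $ k * exp b"
      using le p(1) by (auto intro!: mult_left_mono)
    have "a \<bullet> column j A < b" using le[of j] eq[of j] assms(5) by simp
    then show "\<exists>k\<in>UNIV. p $ k * exp (a \<bullet> column k A) < p $ k * exp b"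
      using p(1)[of j] \<open>p $ j \<noteq> 0\<close> by (intro bexI[of _ j]) auto
  qed simp
  then have gt1: "1 < exp b / Z"
    using p(2) Z by (simp add: sum_distrib_right[symmetric])
  have "(tilt A a p $ k) ^ n k = (p $ k) ^ n k * (exp b / Z) ^ n k" for k
  proof (cases "n k = 0")
    case False
    then have "a \<bullet> column k A = b" using assms(3) eq by (auto simp: count_support_def)
    then show ?thesis by (simp add: tilt_def Z_def[symmetric] power_mult_distrib power_divide)
  qed simp
  then have lik: "(\<Prod>k\<in>UNIV. (tilt A a p $ k) ^ n k)
      = (\<Prod>k\<in>UNIV. (p $ k) ^ n k) * (exp b / Z) ^ (\<Sum>k\<in>UNIV. n k)"
    by (simp add: prod.distrib power_sum)
  have "(\<Sum>k\<in>UNIV. n k) > 0" by (rule total_count_pos[OF assms(1)])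
  then have "1 < (exp b / Z) ^ (\<Sum>k\<in>UNIV. n k)" using gt1 by (intro one_less_power)
  then have "(\<Prod>k\<in>UNIV. (p $ k) ^ n k) < (\<Prod>k\<in>UNIV. (tilt A a p $ k) ^ n k)"
    using EMLE_likelihood_pos[OF assms(4)] by (simp add: lik)
  moreover from this have "(\<Prod>k\<in>UNIV. (tilt A a p $ k) ^ n k) > 0"
    using EMLE_likelihood_pos[OF assms(4)] by linarith
  ultimately show False
    using EMLE_likelihood_ge[OF assms(4) tilt_in_closure[OF cl, of a]] by simp
qed


section \<open>Independent families of parameter functions\<close>

text \<open>
  The functions \<open>\<mu>\<^sub>i\<close> are represented by the vectors \<open>f\<^sub>i - f\<^sub>z\<close>, and a linear functional can be
  prescribed on independent vectors. As functionals on \<open>\<real>\<^sup>J\<close> are inner products with a vector,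
  the prescribed values are attained at a parameter.
\<close>

lemma lin_indep_interpolation:
  fixes A :: "real^'i::finite^'j::finite"
  assumes "lin_indep_on (mu A z) L"
  shows "\<exists>d. \<forall>i\<in>L. mu A z i d = b i"
proof -
  define f where "f i = column i A - column z A" for i
  have mu: "mu A z i \<theta> = f i \<bullet> \<theta>" for i \<theta> by (simp add: mu_def f_def inner_commute)
  have zero: "\<forall>i\<in>L. c i = 0" if "(\<Sum>i\<in>L. c i *\<^sub>R f i) = 0" for c
  proof -
    have "(\<Sum>i\<in>L. c i * mu A z i \<theta>) = (\<Sum>i\<in>L. c i *\<^sub>R f i) \<bullet> \<theta>" for \<theta>
      by (simp add: mu inner_sum_left)
    then show ?thesis using assms that by (simp add: lin_indep_on_def)
  qed
  have inj: "inj_on f L"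
  proof (rule inj_onI, rule ccontr)
    fix i j assume ij: "i \<in> L" "j \<in> L" "f i = f j" "i \<noteq> j"
    let ?c = "\<lambda>k. (if k = i then 1 else 0) - (if k = j then 1 else 0 :: real)"
    have "(\<Sum>k\<in>L. ?c k *\<^sub>R f k)
        = (\<Sum>k\<in>L. if k = i then f k else 0) - (\<Sum>k\<in>L. if k = j then f k else 0)"
      by (subst sum_subtractf[symmetric]) (auto intro!: sum.cong)
    also have "\<dots> = 0" using ij by simp
    finally have "?c i = 0" by (rule bspec[OF zero ij(1)])
    then show False using ij(4) by simp
  qed
  have "independent (f ` L)"
  proof (rule independent_if_scalars_zero)
    fix c x assume "(\<Sum>x\<in>f ` L. c x *\<^sub>R x) = 0" "x \<in> f ` L"
    then show "c x = 0" using zero[of "\<lambda>i. c (f i)"] by (auto simp: sum.reindex[OF inj])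
  qed simp
  then obtain g :: "real^'j \<Rightarrow> real"
    where g: "linear g" "\<forall>x\<in>f ` L. g x = b (inv_into L f x)"
    using linear_independent_extend[where f = "\<lambda>x. b (inv_into L f x)"] by metis
  have "mu A z i (adjoint g 1) = b i" if "i \<in> L" for i
  proof -
    have "mu A z i (adjoint g 1) = g (f i)"
      unfolding mu adjoint_works[OF g(1)] by simp
    also have "\<dots> = b (inv_into L f (f i))" using g(2) that by blast
    also have "\<dots> = b i" by (simp only: inv_into_f_f[OF inj that])
    finally show ?thesis .
  qed
  then show ?thesis by blast
qed

lemma maximal_lin_indep_zero_propagates:
  fixes g :: "'i::finite \<Rightarrow> 'b \<Rightarrow> real"
  assumes max: "maximal_lin_indep g F L" and zero: "\<And>i. i \<in> L \<Longrightarrow> g i d = 0" and "j \<in> F"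
  shows "g j d = 0"
proof (cases "j \<in> L")
  case False
  have "\<not> lin_indep_on g (insert j L)"
    using max False \<open>j \<in> F\<close> unfolding maximal_lin_indep_def by blast
  then obtain c where c: "\<forall>\<theta>. (\<Sum>i\<in>insert j L. c i * g i \<theta>) = 0" "\<exists>i\<in>insert j L. c i \<noteq> 0"
    by (auto simp: lin_indep_on_def)
  then have split: "c j * g j \<theta> + (\<Sum>i\<in>L. c i * g i \<theta>) = 0" for \<theta>
    using False by simp
  have "c j \<noteq> 0"
  proof
    assume "c j = 0"
    with split have "\<forall>i\<in>L. c i = 0"
      using max by (simp add: maximal_lin_indep_def lin_indep_on_def)
    with c(2) \<open>c j = 0\<close> show False by auto
  qed
  moreover have "c j * g j d = 0" using split[of d] zero by simp
  ultimately show ?thesis by simp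
qed (rule zero)


section \<open>Well-defined limits\<close>

lemma well_defined_limitI:
  assumes "\<And>\<theta>. (\<lambda>s. exp_density A (\<theta> s)) \<longlonglongrightarrow> p \<Longrightarrow> (\<lambda>s. g (\<theta> s)) \<longlonglongrightarrow> l"
  shows "well_defined_limit A p g"
  using assms unfolding well_defined_limit_def by (metis convergentI limI)

text \<open>
  Well-definedness is refuted by a direction that leaves the limit distribution unchanged: the
  translated parameters are admissible too, and their limit differs by \<open>g d\<close>.
\<close>

lemma well_defined_limit_translate:
  fixes A :: "real^'i::finite^'j::finite"
  assumes wd: "well_defined_limit A p g" and lim: "(\<lambda>s. exp_density A (\<theta> s)) \<longlonglongrightarrow> p"
    and "tilt A d p = p" and g: "\<And>\<theta>. g (\<theta> + d) = g \<theta> + g d"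
  shows "g d = 0"
proof -
  have lim': "(\<lambda>s. exp_density A (\<theta> s + d)) \<longlonglongrightarrow> p"
    using exp_density_translate_tendsto[OF lim, of d] assms(3) by simp
  obtain l where l: "(\<lambda>s. g (\<theta> s)) \<longlonglongrightarrow> l"
    using wd lim by (auto simp: well_defined_limit_def convergent_def)
  then have "(\<lambda>s. g (\<theta> s + d)) \<longlonglongrightarrow> l + g d" unfolding g by (intro tendsto_intros)
  then have "lim (\<lambda>s. g (\<theta> s + d)) = l + g d" by (rule limI)
  moreover have "lim (\<lambda>s. g (\<theta> s)) = l" using l by (rule limI)
  moreover have "lim (\<lambda>s. g (\<theta> s)) = lim (\<lambda>s. g (\<theta> s + d))"
    using wd[unfolded well_defined_limit_def, THEN conjunct2, rule_format, OF conjI[OF lim lim']] .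
  ultimately show ?thesis by simp
qed

lemma mu_tendsto:
  assumes "(\<lambda>s. exp_density A (\<theta> s)) \<longlonglongrightarrow> p" "p $ i > 0" "p $ z > 0"
  shows "(\<lambda>s. mu A z i (\<theta> s)) \<longlonglongrightarrow> ln (p $ i / p $ z)"
  unfolding mu_eq_ln_ratio by (intro tendsto_intros assms(1)) (use assms in auto)

theorem lemma4p2:
  fixes A :: "real^'i::finite^'j::finite"
    and n :: "'i \<Rightarrow> nat"
    and pstar :: "real^'i"
    and Ft F1 F2 L1 L2 L :: "'i set"
    and z :: 'i
  assumes "n \<noteq> (\<lambda>_. 0)"
    and "smallest_facial A (count_support n) Ft"
    and "is_EMLE A n pstar"
    and "count_support n \<subseteq> F1" and "F1 \<subseteq> Ft" and "Ft \<subseteq> F2"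
    and "z \<in> count_support n"
    and "maximal_lin_indep (mu A z) F1 L1"
    and "L1 \<subseteq> L2" and "L2 - L1 \<subseteq> F2 - F1" and "maximal_lin_indep (mu A z) F2 L2"
    and "L2 \<subseteq> L" and "L - L2 \<subseteq> UNIV - F2" and "maximal_lin_indep (mu A z) UNIV L"
  shows "(\<forall>i\<in>L1. well_defined_limit A pstar (mu A z i)) \<and>
    (\<forall>a. well_defined_limit A pstar (\<lambda>\<theta>. \<Sum>i\<in>L1. a i * mu A z i \<theta>)) \<and>
    (\<forall>a. well_defined_limit A pstar (\<lambda>\<theta>. \<Sum>i\<in>L. a i * mu A z i \<theta>) \<longrightarrow>
       (\<forall>i\<in>L - L2. a i = 0)) \<and>
    (\<forall>a. (\<exists>j\<in>L - L2. a j \<noteq> 0) \<longrightarrow>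
       \<not> well_defined_limit A pstar (\<lambda>\<theta>. \<Sum>i\<in>L. a i * mu A z i \<theta>))"
proof -
  have facial: "facial A Ft" "count_support n \<subseteq> Ft"
    using assms(2) by (auto simp: smallest_facial_def)
  have pos: "pstar $ i > 0" if "i \<in> Ft" for i
    using EMLE_pos_on_smallest_facial assms(1-3) that by blast
  have off: "pstar $ i = 0" if "i \<notin> Ft" for i
    using EMLE_zero_off_facial[OF assms(1) facial assms(3) that] .
  have "L1 \<subseteq> Ft" using assms(5,8) by (auto simp: maximal_lin_indep_def)
  have mu_lim: "(\<lambda>s. mu A z i (\<theta> s)) \<longlonglongrightarrow> ln (pstar $ i / pstar $ z)"
    if "(\<lambda>s. exp_density A (\<theta> s)) \<longlonglongrightarrow> pstar" "i \<in> L1" for \<theta> i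
    using that \<open>L1 \<subseteq> Ft\<close> facial(2) assms(7) by (intro mu_tendsto pos) auto
  have single: "well_defined_limit A pstar (mu A z i)" if "i \<in> L1" for i
    using mu_lim that by (intro well_defined_limitI)
  have combination: "well_defined_limit A pstar (\<lambda>\<theta>. \<Sum>i\<in>L1. a i * mu A z i \<theta>)" for a
    by (rule well_defined_limitI[where l = "\<Sum>i\<in>L1. a i * ln (pstar $ i / pstar $ z)"])
       (intro tendsto_intros mu_lim)
  have vanish: "a i = 0"
    if wd: "well_defined_limit A pstar (\<lambda>\<theta>. \<Sum>i\<in>L. a i * mu A z i \<theta>)" and i: "i \<in> L - L2"
    for a i
  proof -
    have "pstar \<in> closure (exp_family A)"
      using assms(3) by (simp add: is_EMLE_def is_arg_max_def)
    then obtain \<theta> where lim: "(\<lambda>s. exp_density A (\<theta> s)) \<longlonglongrightarrow> pstar"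
      by (rule exp_family_closure_sequence)
    (* On L - L2 the direction takes the values of a itself, so that the sum changes by a sum of
       squares. *)
    have "lin_indep_on (mu A z) L" using assms(14) by (simp add: maximal_lin_indep_def)
    from lin_indep_interpolation[OF this, of "\<lambda>i. if i \<in> L2 then 0 else a i"]
    obtain d where d: "\<And>i. i \<in> L \<Longrightarrow> mu A z i d = (if i \<in> L2 then 0 else a i)"
      by blast
    have "mu A z k d = 0" if "k \<in> F2" for k
    proof (rule maximal_lin_indep_zero_propagates[OF assms(11) _ that])
      show "mu A z i d = 0" if "i \<in> L2" for i using d[of i] that assms(12) by auto
    qed
    then have "mu A z k d = 0" if "pstar $ k \<noteq> 0" for k
      using off[of k] that assms(6) by blast
    then have "tilt A d pstar = pstar"
      by (rule tilt_trivial[OF exp_density_limit_distribution(2)[OF lim]])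
    then have "(\<Sum>i\<in>L. a i * mu A z i d) = 0"
      by (intro well_defined_limit_translate[OF wd lim])
         (simp_all add: mu_def inner_add_left distrib_left sum.distrib)
    moreover have "(\<Sum>i\<in>L. a i * mu A z i d) = (\<Sum>i\<in>L. if i \<in> L2 then 0 else (a i)\<^sup>2)"
      by (intro sum.cong) (auto simp: d power2_eq_square)
    ultimately have "(\<Sum>i\<in>L. if i \<in> L2 then 0 else (a i)\<^sup>2) = 0" by simp
    then have "\<forall>i\<in>L. (if i \<in> L2 then 0 else (a i)\<^sup>2) = 0"
      by (simp add: sum_nonneg_eq_0_iff)
    then show ?thesis using i by auto
  qed
  show ?thesis using single combination vanish by blast
qed

end
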